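(* For every odd positive integer $k=2m+1$ ($m\geq 1$), there exists a smallest integer $N(k)\ge k$ such that for all integers $n\geq N(k)$, the Fermat-Weber point $\mathcal{W}(C_n(k))$ coincides with the root vertex of the chain $C_n(k)$. Moreover, $$N(k)=\min\Big\{t\in\mathbb{N}: t\ge k,\ 2\sum_{i=1}^m\sin\Big(\frac{i\pi}{t}\Big)-1\leq 0\Big\}.$$
   Context: The Fermat-Weber point $\mathcal{W}(S)$ of a finite set $S=\{p_1,\dots,p_r\}$ of points in the plane $\mathbb{R}^2$ is the point $p\in\mathbb{R}^2$ minimizing $\sum_{i=1}^r d(p,p_i)$, where $d$ is the Euclidean distance; it is unique when the points of $S$ are not all collinear. For integers $n\ge k\geq 3$, a $k$-chain $C_n(k)$ is the segment of the boundary of a regular $n$-gon formed by $k$ consecutive vertices of the $n$-gon; the $n$-gon may be taken to be inscribed in a unit circle. $\mathcal{W}(C_n(k))$ denotes the Fermat-Weber point of the set of the $k$ vertices of the chain. If $k=2m+1$ is odd and the vertices of the chain in consecutive order are $p_1,\dots,p_{2m+1}$, the root vertex of $C_n(k)$ is the middle vertex $p_{m+1}$. *)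

theory Defs
  imports "HOL-Analysis.Analysis"
begin

definition dist_sum :: "(real^2) set \<Rightarrow> real^2 \<Rightarrow> real" where
  "dist_sum S p = (\<Sum>s\<in>S. dist p s)"

text \<open>
  The description is well defined only when the minimizer is unique, which is the case for
  finite non-collinear sets, see \<open>fermat_weber_ex1\<close> below.
\<close>
definition fermat_weber :: "(real^2) set \<Rightarrow> real^2" where
  "fermat_weber S = (THE p. \<forall>q. dist_sum S p \<le> dist_sum S q)"

definition ngon_vertex :: "nat \<Rightarrow> nat \<Rightarrow> real^2" where
  "ngon_vertex n j = vector [cos (2 * pi * real j / real n), sin (2 * pi * real j / real n)]"

text \<open>
  A chain is determined up to congruence by \<open>n\<close> and \<open>k\<close>; the representative below consists of
  the vertices \<open>p\<^sub>1, \<dots>, p\<^sub>k\<close> of the regular \<open>n\<close>-gon inscribed in the unit circle.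
  The vertices are distinct only for \<open>n \<ge> k\<close>.
\<close>
definition chain :: "nat \<Rightarrow> nat \<Rightarrow> (real^2) set" where
  "chain n k = ngon_vertex n ` {1..k}"

text \<open>Intended for odd \<open>k\<close>: for \<open>k = 2 * m + 1\<close> the index is \<open>m + 1\<close>.\<close>
definition root_vertex :: "nat \<Rightarrow> nat \<Rightarrow> real^2" where
  "root_vertex n k = ngon_vertex n ((k + 1) div 2)"

lemma fermat_weber_ex1:
  assumes fin: "finite S" and nc: "\<not> collinear S"
  shows "\<exists>!p. \<forall>q. dist_sum S p \<le> dist_sum S q"
proof -
  obtain a where a: "a \<in> S" using nc by (cases "S = {}") auto
  have "continuous_on (cball a (dist_sum S a)) (dist_sum S)"
    unfolding dist_sum_def by (intro continuous_intros)
  moreover have nn: "dist_sum S a \<ge> 0"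
    unfolding dist_sum_def by (simp add: sum_nonneg)
  ultimately obtain p where p: "\<forall>q\<in>cball a (dist_sum S a). dist_sum S p \<le> dist_sum S q"
    using continuous_attains_inf[of "cball a (dist_sum S a)" "dist_sum S"] by auto
  have pmin: "dist_sum S p \<le> dist_sum S q" for q
  proof (cases "q \<in> cball a (dist_sum S a)")
    case False
    have "dist q a \<le> dist_sum S q"
      unfolding dist_sum_def by (rule member_le_sum[OF a _ fin]) simp
    moreover have "dist_sum S p \<le> dist_sum S a" using p nn by simp
    ultimately show ?thesis using False by (simp add: dist_commute)
  qed (use p in simp)
  show ?thesis
  proof (rule ex1I[of _ p])
    show "\<forall>q. dist_sum S p \<le> dist_sum S q" using pmin by blast
  next
    fix q assume qmin: "\<forall>r. dist_sum S q \<le> dist_sum S r"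
    show "q = p"
    proof (rule ccontr)
      assume ne: "q \<noteq> p"
      define h where "h = midpoint p q"
      have half: "dist h s = norm ((p - s) + (q - s)) / 2" for s
      proof -
        have "h - s = (1/2) *\<^sub>R ((p - s) + (q - s))"
          unfolding h_def midpoint_def by (simp add: vec_eq_iff algebra_simps)
        then show ?thesis by (simp add: dist_norm)
      qed
      have le: "dist h s \<le> (dist p s + dist q s) / 2" for s
        unfolding half using norm_triangle_ineq[of "p - s" "q - s"] by (simp add: dist_norm)
      have "(\<Sum>s\<in>S. (dist p s + dist q s) / 2) = (dist_sum S p + dist_sum S q) / 2"
        unfolding dist_sum_def by (simp add: sum.distrib sum_divide_distrib[symmetric])
      also have "\<dots> \<le> dist_sum S h" using pmin[of h] qmin[rule_format, of h] by simp
      finally have ge: "(\<Sum>s\<in>S. (dist p s + dist q s) / 2) \<le> (\<Sum>s\<in>S. dist h s)"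
        by (simp add: dist_sum_def)
      have "(\<Sum>s\<in>S. (dist p s + dist q s) / 2 - dist h s) = 0"
        using ge sum_mono[of S "dist h" "\<lambda>s. (dist p s + dist q s) / 2"] le
        by (simp add: sum_subtractf)
      then have eq: "dist h s = (dist p s + dist q s) / 2" if "s \<in> S" for s
        using that le fin by (subst (asm) sum_nonneg_eq_0_iff) force+
      have on_line: "\<exists>c. s = p + c *\<^sub>R (q - p)" if s: "s \<in> S" for s
      proof -
        let ?x = "p - s" and ?y = "q - s"
        have "norm (?x + ?y) = norm ?x + norm ?y"
          using eq[OF s] unfolding half by (simp add: dist_norm)
        then have e: "norm ?x *\<^sub>R ?y = norm ?y *\<^sub>R ?x" by (rule iffD1[OF norm_triangle_eq])
        have d: "norm ?x - norm ?y \<noteq> 0"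
        proof
          assume "norm ?x - norm ?y = 0"
          with e have "?x = ?y" by (cases "norm ?x = 0") auto
          with ne show False by simp
        qed
        have "(norm ?x - norm ?y) *\<^sub>R (s - p) = norm ?x *\<^sub>R (q - p)"
          using e by (simp add: algebra_simps)
        then have "s - p = (norm ?x / (norm ?x - norm ?y)) *\<^sub>R (q - p)"
          using d by (metis (no_types, lifting) divide_inverse mult.commute scaleR_left_imp_eq
              scaleR_scaleR right_inverse scaleR_one)
        then show ?thesis by (metis add.commute diff_add_cancel)
      qed
      have "collinear S"
        unfolding collinear_def
      proof (intro exI[of _ "q - p"] ballI)
        fix x y assume "x \<in> S" "y \<in> S"
        then obtain c d where c: "x = p + c *\<^sub>R (q - p)" and d: "y = p + d *\<^sub>R (q - p)"
          using on_line by blast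
        have "x - y = (c - d) *\<^sub>R (q - p)" unfolding c d by (simp add: scaleR_diff_left)
        then show "\<exists>c. x - y = c *\<^sub>R (q - p)" by blast
      qed
      with nc show False by blast
    qed
  qed
qed

end

theory Submission
  imports Defs
begin

text \<open>
  The function \<open>dist_sum S\<close> is convex, and at a point \<open>r\<close> of \<open>S\<close> it is the sum of the distance to
  \<open>r\<close> itself, whose subdifferential at \<open>r\<close> is the closed unit ball, and of the distances to the
  remaining points, which is differentiable at \<open>r\<close> with gradient \<open>-R\<close>, where \<open>R\<close> is the sum of the
  unit vectors pointing from \<open>r\<close> to the remaining points. Hence \<open>r\<close> is a minimizer if and only if
  \<open>norm R \<le> 1\<close> (\<open>dist_sum_minimal_iff\<close>).

  For a chain with \<open>2 * m + 1\<close> vertices and \<open>r\<close> its root vertex, the vertices come in pairs that are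
  symmetric about the axis through \<open>r\<close> and the centre of the circle. The chord from \<open>r\<close> to the
  \<open>i\<close>-th vertex on either side makes the angle \<open>i * pi / n\<close> with the tangent at \<open>r\<close>, so the two unit
  vectors of a pair add up to a vector of length \<open>2 * sin (i * pi / n)\<close> along the axis. All these
  sums point to the centre, so \<open>norm R = 2 * (\<Sum>i=1..m. sin (i * pi / n))\<close>. Since a chain is not
  collinear its Fermat-Weber point is unique, and for every single \<open>n \<ge> k\<close> it is the root vertex if
  and only if this number is at most 1 (\<open>fermat_weber_chain_eq_root_iff\<close>).

  The angles \<open>i * pi / n\<close> lie below \<open>pi / 2\<close>, so the number decreases in \<open>n\<close>; it tends to 0. The
  admissible \<open>n\<close> therefore form a final segment of the integers \<open>\<ge> k\<close>, and its least element is the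
  \<open>N\<close> of the theorem under both descriptions.
\<close>

section \<open>When a point of the set is a Fermat-Weber point\<close>

text \<open>
  This is \<open>sqrt (a\<^sup>2 + x) \<le> a + x / (2 * a)\<close> for \<open>a = norm v\<close>: a first-order expansion of the norm
  with an explicit quadratic error, which takes the place of differentiation.
\<close>

lemma norm_diff_le_quadratic:
  fixes v w :: "'a::real_inner"
  assumes "v \<noteq> 0"
  shows "norm (v - w) \<le> norm v - sgn v \<bullet> w + (norm w)\<^sup>2 / (2 * norm v)"
proof -
  have pos: "norm v > 0" using assms by simp
  have sq: "(norm (v - w))\<^sup>2 = (norm v)\<^sup>2 - 2 * (v \<bullet> w) + (norm w)\<^sup>2"
    by (simp add: power2_norm_eq_inner inner_diff inner_commute)
  have inner: "sgn v \<bullet> w = (v \<bullet> w) / norm v"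
    by (simp add: sgn_div_norm divide_inverse mult.commute)
  have "0 \<le> (norm (v - w) - norm v)\<^sup>2" by simp
  then have "2 * norm v * norm (v - w) \<le> (norm (v - w))\<^sup>2 + (norm v)\<^sup>2"
    by (simp add: power2_diff algebra_simps)
  then have "norm (v - w) \<le> ((norm (v - w))\<^sup>2 + (norm v)\<^sup>2) / (2 * norm v)"
    using pos by (simp add: field_simps)
  also have "\<dots> = norm v - sgn v \<bullet> w + (norm w)\<^sup>2 / (2 * norm v)"
    unfolding sq inner using pos by (simp add: field_simps power2_eq_square)
  finally show ?thesis .
qed

text \<open>
  The norm is convex, so it lies above its tangent at \<open>v\<close>.
\<close>

lemma norm_diff_ge_linear:
  fixes v w :: "'a::real_inner"
  shows "norm v - sgn v \<bullet> w \<le> norm (v - w)"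
proof (cases "v = 0")
  case False
  have "sgn v \<bullet> v = norm v"
    using False by (simp add: sgn_div_norm dot_square_norm power2_eq_square)
  then have "norm v - sgn v \<bullet> w = sgn v \<bullet> (v - w)" by (simp add: inner_diff_right)
  also have "\<dots> \<le> norm (sgn v) * norm (v - w)" by (rule norm_cauchy_schwarz)
  also have "\<dots> = norm (v - w)" using False by (simp add: norm_sgn)
  finally show ?thesis .
qed simp

text \<open>
  Let \<open>R\<close> be the sum of unit vectors on the right. If \<open>norm R \<le> 1\<close>, then by the tangent inequality
  a move away from \<open>r\<close> cannot shorten the distances to the other points by more than it lengthens
  the distance to \<open>r\<close>. If \<open>norm R > 1\<close>, a small step from \<open>r\<close> in the direction of \<open>R\<close> decreases
  the sum.
\<close>

lemma dist_sum_minimal_iff: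
  fixes S :: "(real^2) set"
  assumes fin: "finite S" and r: "r \<in> S"
  shows "(\<forall>q. dist_sum S r \<le> dist_sum S q) \<longleftrightarrow> norm (\<Sum>s\<in>S - {r}. sgn (s - r)) \<le> 1"
proof -
  define T where "T = S - {r}"
  define R where "R = (\<Sum>s\<in>T. sgn (s - r))"
  have split: "dist_sum S (r + d) = norm d + (\<Sum>s\<in>T. norm ((s - r) - d))" for d
    unfolding dist_sum_def T_def sum.remove[OF fin r]
    by (simp add: dist_norm norm_minus_commute algebra_simps)
  have at_r: "dist_sum S r = (\<Sum>s\<in>T. norm (s - r))"
    using split[of 0] by simp
  have linear: "(\<Sum>s\<in>T. norm (s - r) - sgn (s - r) \<bullet> d) = dist_sum S r - R \<bullet> d" for d
    by (simp add: at_r R_def sum_subtractf inner_sum_left)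
  show ?thesis
    unfolding T_def[symmetric] R_def[symmetric]
  proof
    assume short: "norm R \<le> 1"
    show "\<forall>q. dist_sum S r \<le> dist_sum S q"
    proof
      fix q
      define d where "d = q - r"
      have "R \<bullet> d \<le> norm R * norm d" by (rule norm_cauchy_schwarz)
      also have "\<dots> \<le> norm d" using short by (simp add: mult_left_le_one_le)
      finally have "dist_sum S r \<le> norm d + (dist_sum S r - R \<bullet> d)" by simp
      also have "\<dots> \<le> dist_sum S (r + d)"
        unfolding split linear[symmetric] by (intro add_left_mono sum_mono norm_diff_ge_linear)
      finally show "dist_sum S r \<le> dist_sum S q" by (simp add: d_def)
    qed
  next
    assume min: "\<forall>q. dist_sum S r \<le> dist_sum S q"
    define K where "K = (\<Sum>s\<in>T. (norm R)\<^sup>2 / (2 * norm (s - r)))"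
    have K: "K \<ge> 0" unfolding K_def by (intro sum_nonneg) simp
    have step: "t * ((norm R)\<^sup>2 - norm R) \<le> t\<^sup>2 * K" if t: "t > 0" for t :: real
    proof -
      have "dist_sum S r \<le> dist_sum S (r + t *\<^sub>R R)" using min by blast
      also have "\<dots> \<le> norm (t *\<^sub>R R) + (\<Sum>s\<in>T. (norm (s - r) - sgn (s - r) \<bullet> (t *\<^sub>R R))
          + (norm (t *\<^sub>R R))\<^sup>2 / (2 * norm (s - r)))"
        unfolding split
        by (intro add_left_mono sum_mono norm_diff_le_quadratic) (auto simp: T_def)
      also have "\<dots> = t * norm R + (dist_sum S r - t * (norm R)\<^sup>2) + t\<^sup>2 * K"
        unfolding sum.distrib linear
        using t by (simp add: K_def sum_distrib_left power_mult_distrib dot_square_norm)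
      finally show ?thesis by (simp add: algebra_simps)
    qed
    show "norm R \<le> 1"
    proof (rule ccontr)
      assume "\<not> norm R \<le> 1"
      then have "norm R > 1" by simp
      then have "norm R * 1 < norm R * norm R" by (intro mult_strict_left_mono) linarith+
      then have c: "(norm R)\<^sup>2 - norm R > 0" by (simp add: power2_eq_square)
      \<comment> \<open>A step length at which the quadratic error is still smaller than the linear gain.\<close>
      define t where "t = ((norm R)\<^sup>2 - norm R) / (K + 1)"
      have t: "t > 0" using c K by (simp add: t_def)
      from step[OF t] have "(norm R)\<^sup>2 - norm R \<le> t * K"
        using t by (simp add: power2_eq_square)
      moreover have "(norm R)\<^sup>2 - norm R = t * (K + 1)"
        using K by (simp add: t_def)
      ultimately show False using t by (simp add: algebra_simps)
    qed
  qed
qed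

lemma fermat_weber_eq_iff:
  assumes "finite S" and "\<not> collinear S"
  shows "fermat_weber S = p \<longleftrightarrow> (\<forall>q. dist_sum S p \<le> dist_sum S q)"
  using theI'[OF fermat_weber_ex1[OF assms]] fermat_weber_ex1[OF assms]
  unfolding fermat_weber_def by blast

section \<open>Chords of the unit circle\<close>

definition circle_point :: "real \<Rightarrow> real^2" where
  "circle_point x = vector [cos x, sin x]"

lemma ngon_vertex_eq_circle_point: "ngon_vertex n j = circle_point (2 * pi * real j / real n)"
  by (simp add: ngon_vertex_def circle_point_def)

lemma norm_circle_point [simp]: "norm (circle_point x) = 1"
  by (simp add: circle_point_def norm_vec_def L2_set_def sum_2)

text \<open>
  The chord between two points is orthogonal to the bisector of their angles; the factor in front
  is its signed length.
\<close>

lemma circle_point_diff: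
  "circle_point (a + 2 * x) - circle_point a = (2 * sin x) *\<^sub>R circle_point (a + x + pi / 2)"
proof -
  have a: "a = (a + x) - x" "a + 2 * x = (a + x) + x" by simp_all
  have "cos (a + 2 * x) - cos a = 2 * sin x * cos (a + x + pi / 2)"
    by (subst a(2), subst (2) a(1)) (simp only: cos_add cos_diff, simp add: cos_add)
  moreover have "sin (a + 2 * x) - sin a = 2 * sin x * sin (a + x + pi / 2)"
    by (subst a(2), subst (2) a(1)) (simp only: sin_add sin_diff, simp add: sin_add)
  ultimately show ?thesis
    by (simp add: circle_point_def vec_eq_iff forall_2)
qed

text \<open>
  The component of each chord along the tangent at \<open>a\<close> cancels against that of its mirror image.
\<close>

lemma sgn_symmetric_chords:
  assumes "0 < x" and "x < pi"
  shows "sgn (circle_point (a + 2 * x) - circle_point a)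
       + sgn (circle_point (a - 2 * x) - circle_point a) = (- 2 * sin x) *\<^sub>R circle_point a"
proof -
  have pos: "sin x > 0" using assms by (rule sin_gt_zero)
  have "sgn (circle_point (a + 2 * x) - circle_point a) = circle_point (a + x + pi / 2)"
    unfolding circle_point_diff using pos by (simp add: sgn_scaleR sgn_div_norm)
  moreover have "sgn (circle_point (a - 2 * x) - circle_point a) = - circle_point (a - x + pi / 2)"
    using circle_point_diff[of a "- x"] pos by (simp add: sgn_minus sgn_scaleR sgn_div_norm)
  ultimately show ?thesis
    by (simp add: circle_point_def vec_eq_iff forall_2 cos_add sin_add cos_diff sin_diff)
qed

text \<open>
  Of three points on a line one lies between the other two, and if it differs from them it is
  strictly closer to the centre than one of them.
\<close>

lemma not_collinear_sphere:
  fixes a b c :: "'a::euclidean_space"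
  assumes "norm a = 1" "norm b = 1" "norm c = 1" "a \<noteq> b" "b \<noteq> c" "a \<noteq> c"
  shows "\<not> collinear {a, b, c}"
proof -
  have "\<not> between (x, y) z"
    if "norm x = 1" "norm y = 1" "norm z = 1" "z \<noteq> x" "z \<noteq> y" for x y z :: 'a
  proof
    assume "between (x, y) z"
    then have "z \<in> open_segment x y"
      using that by (simp add: between_mem_segment open_segment_def)
    from dist_decreases_open_segment[OF this, of 0] show False using that by simp
  qed
  then show ?thesis
    unfolding collinear_between_cases using assms by metis
qed

lemma norm_ngon_vertex [simp]: "norm (ngon_vertex n j) = 1"
  by (simp add: ngon_vertex_eq_circle_point)

section \<open>The chains of regular polygons\<close>

lemma inj_on_ngon_vertex:
  assumes "k \<le> n"
  shows "inj_on (ngon_vertex n) {1..k}"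
proof -
  have "ngon_vertex n j \<noteq> ngon_vertex n l" if "1 \<le> j" "j < l" "l \<le> k" for j l
  proof -
    define x where "x = pi * real (l - j) / real n"
    have n: "real n > 0" using that assms by linarith
    have "real (l - j) < real n" using that assms by linarith
    then have "0 < x" "x < pi"
      using that n by (simp_all add: x_def pos_divide_less_eq)
    then have "sin x > 0" by (rule sin_gt_zero)
    moreover have "2 * pi * real l / real n = 2 * pi * real j / real n + 2 * x"
      using that n by (simp add: x_def of_nat_diff field_simps)
    ultimately have "norm (ngon_vertex n l - ngon_vertex n j) > 0"
      by (simp add: ngon_vertex_eq_circle_point circle_point_diff)
    then show ?thesis by auto
  qed
  then show ?thesis
    by (intro linorder_inj_onI) auto
qed

lemma not_collinear_chain:
  assumes "3 \<le> k" and "k \<le> n"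
  shows "\<not> collinear (chain n k)"
proof -
  have "ngon_vertex n i \<noteq> ngon_vertex n j" if "i \<in> {1..k}" "j \<in> {1..k}" "i \<noteq> j" for i j
    using inj_on_ngon_vertex[OF assms(2)] that by (meson inj_onD)
  then have "\<not> collinear {ngon_vertex n 1, ngon_vertex n 2, ngon_vertex n 3}"
    using assms(1) by (intro not_collinear_sphere) simp_all
  moreover have "{ngon_vertex n 1, ngon_vertex n 2, ngon_vertex n 3} \<subseteq> chain n k"
    using assms by (auto simp: chain_def)
  ultimately show ?thesis using collinear_subset by blast
qed

lemma sum_sgn_from_root_vertex:
  assumes k: "k = 2 * m + 1" and n: "k \<le> n"
  shows "(\<Sum>s\<in>chain n k - {root_vertex n k}. sgn (s - root_vertex n k))
       = (- 2 * (\<Sum>i=1..m. sin (real i * pi / real n))) *\<^sub>R root_vertex n k"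
proof -
  let ?r = "root_vertex n k"
  let ?g = "\<lambda>j. sgn (ngon_vertex n j - ?r)"
  have root: "?r = ngon_vertex n (m + 1)" by (simp add: root_vertex_def k)
  note inj = inj_on_ngon_vertex[OF n]
  have n0: "real n > 0" using n k by simp
  have pair: "?g (m + 1 + i) + ?g (m + 1 - i) = (- 2 * sin (real i * pi / real n)) *\<^sub>R ?r"
    if i: "i \<in> {1..m}" for i
  proof -
    define x where "x = real i * pi / real n"
    define a where "a = 2 * pi * real (m + 1) / real n"
    have "real i < real n" using i k n by simp
    then have x: "0 < x" "x < pi" using i n0 by (simp_all add: x_def field_simps)
    have "2 * pi * real (m + 1 + i) / real n = a + 2 * x"
      by (simp add: a_def x_def field_simps add_divide_distrib)
    moreover have "2 * pi * real (m + 1 - i) / real n = a - 2 * x"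
      using i n0 by (simp add: a_def x_def of_nat_diff field_simps)
    ultimately show ?thesis
      using sgn_symmetric_chords[OF x, of a]
      unfolding root ngon_vertex_eq_circle_point x_def[symmetric] by (simp add: a_def)
  qed
  have up: "(\<Sum>j\<in>{m+2..k}. ?g j) = (\<Sum>i=1..m. ?g (m + 1 + i))"
    by (rule sum.reindex_bij_witness[of _ "\<lambda>i. m + 1 + i" "\<lambda>j. j - (m + 1)"]) (auto simp: k)
  have down: "(\<Sum>j\<in>{1..m}. ?g j) = (\<Sum>i=1..m. ?g (m + 1 - i))"
    by (rule sum.reindex_bij_witness[of _ "\<lambda>i. m + 1 - i" "\<lambda>j. m + 1 - j"]) auto
  have "chain n k - {?r} = ngon_vertex n ` ({1..k} - {m + 1})"
    unfolding chain_def root using inj k by (subst inj_on_image_set_diff[OF inj]) auto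
  also have "{1..k} - {m + 1} = {m+2..k} \<union> {1..m}" using k by auto
  finally have img: "chain n k - {?r} = ngon_vertex n ` ({m+2..k} \<union> {1..m})" .
  have "(\<Sum>s\<in>chain n k - {?r}. sgn (s - ?r)) = (\<Sum>j\<in>{m+2..k} \<union> {1..m}. ?g j)"
    unfolding img by (subst sum.reindex) (auto intro: inj_on_subset[OF inj] simp: k)
  also have "\<dots> = (\<Sum>j\<in>{m+2..k}. ?g j) + (\<Sum>j\<in>{1..m}. ?g j)"
    by (rule sum.union_disjoint) auto
  also have "\<dots> = (\<Sum>i=1..m. ?g (m + 1 + i) + ?g (m + 1 - i))"
    unfolding up down by (simp add: sum.distrib)
  also have "\<dots> = (\<Sum>i=1..m. (- 2 * sin (real i * pi / real n)) *\<^sub>R ?r)"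
    by (intro sum.cong refl pair)
  finally show ?thesis by (simp add: scaleR_left.sum sum_distrib_left)
qed

text \<open>
  The criterion holds for each \<open>n\<close> separately. Its necessity for a single \<open>n\<close> is what makes the
  threshold of the theorem sharp.
\<close>

lemma fermat_weber_chain_eq_root_iff:
  assumes m: "m \<ge> 1" and k: "k = 2 * m + 1" and n: "k \<le> n"
  shows "fermat_weber (chain n k) = root_vertex n k \<longleftrightarrow>
    2 * (\<Sum>i=1..m. sin (real i * pi / real n)) - 1 \<le> 0"
proof -
  have fin: "finite (chain n k)" by (simp add: chain_def)
  have nc: "\<not> collinear (chain n k)" using m k n by (intro not_collinear_chain) auto
  have mem: "root_vertex n k \<in> chain n k" by (auto simp: chain_def root_vertex_def k)
  have unit: "norm (root_vertex n k) = 1"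
    by (simp add: root_vertex_def)
  have "0 \<le> (\<Sum>i=1..m. sin (real i * pi / real n))"
  proof (intro sum_nonneg sin_ge_zero)
    fix i assume "i \<in> {1..m}"
    then have "real i \<le> real n" using k n by simp
    then show "real i * pi / real n \<le> pi" using k n by (simp add: field_simps)
  qed simp
  then have "norm (\<Sum>s\<in>chain n k - {root_vertex n k}. sgn (s - root_vertex n k))
      = 2 * (\<Sum>i=1..m. sin (real i * pi / real n))"
    unfolding sum_sgn_from_root_vertex[OF k n] by (simp add: unit)
  then show ?thesis
    unfolding fermat_weber_eq_iff[OF fin nc] dist_sum_minimal_iff[OF fin mem] by simp
qed

section \<open>The threshold\<close>

lemma sum_sin_antimono:
  assumes "2 * m + 1 \<le> t" and "t \<le> n"
  shows "(\<Sum>i=1..m. sin (real i * pi / real n)) \<le> (\<Sum>i=1..m. sin (real i * pi / real t))"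
proof (intro sum_mono sin_monotone_2pi_le)
  fix i assume i: "i \<in> {1..m}"
  have t: "real t > 0" using assms by simp
  show "real i * pi / real n \<le> real i * pi / real t"
    using assms t by (intro divide_left_mono) auto
  have "real i * 2 \<le> real t" using i assms by simp
  from mult_right_mono[OF this pi_ge_zero] show "real i * pi / real t \<le> pi / 2"
    using t by (simp add: field_simps)
  have "0 \<le> real i * pi / real n" by simp
  then show "- (pi / 2) \<le> real i * pi / real n" using pi_gt_zero by linarith
qed

lemma sum_sin_tendsto_0:
  "(\<lambda>t. \<Sum>i=1..m. sin (real i * pi / real t)) \<longlonglongrightarrow> 0"
proof -
  have "(\<lambda>t. sin (real i * pi / real t)) \<longlonglongrightarrow> sin 0" for i
    by (intro tendsto_sin lim_const_over_n)
  then have "(\<lambda>t. \<Sum>i=1..m. sin (real i * pi / real t)) \<longlonglongrightarrow> (\<Sum>i=1..m. sin 0)"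
    by (intro tendsto_sum)
  then show ?thesis by simp
qed

theorem theorem1:
  fixes k m :: nat
  assumes "m \<ge> 1" and "k = 2 * m + 1"
  shows "\<exists>N\<ge>k.
    (\<forall>n\<ge>N. fermat_weber (chain n k) = root_vertex n k) \<and>
    (\<forall>M\<ge>k. (\<forall>n\<ge>M. fermat_weber (chain n k) = root_vertex n k) \<longrightarrow> N \<le> M) \<and>
    N \<in> {t::nat. t \<ge> k \<and> 2 * (\<Sum>i=1..m. sin (real i * pi / real t)) - 1 \<le> 0} \<and>
    (\<forall>t\<in>{t::nat. t \<ge> k \<and> 2 * (\<Sum>i=1..m. sin (real i * pi / real t)) - 1 \<le> 0}. N \<le> t)"
proof -
  define P where "P t \<longleftrightarrow> t \<ge> k \<and> 2 * (\<Sum>i=1..m. sin (real i * pi / real t)) - 1 \<le> 0" for t :: nat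
  define N where "N = (LEAST t. P t)"
  have "\<forall>\<^sub>F t in sequentially. (\<Sum>i=1..m. sin (real i * pi / real t)) < 1 / 2"
    by (rule order_tendstoD[OF sum_sin_tendsto_0]) simp
  then have "\<forall>\<^sub>F t in sequentially. P t"
    using eventually_ge_at_top[of k] by eventually_elim (simp add: P_def)
  then obtain t where "P t" using eventually_happens by force
  then have PN: "P N" unfolding N_def by (rule LeastI)
  have least: "N \<le> t" if "P t" for t using that unfolding N_def by (rule Least_le)
  have root_iff: "fermat_weber (chain n k) = root_vertex n k \<longleftrightarrow> P n" if "n \<ge> k" for n
    using fermat_weber_chain_eq_root_iff[OF assms that] that by (simp add: P_def)
  have "P n" if "n \<ge> N" for n
    using PN that sum_sin_antimono[of m N n] assms(2) by (simp add: P_def)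
  then have above: "\<forall>n\<ge>N. fermat_weber (chain n k) = root_vertex n k"
    using root_iff PN by (simp add: P_def)
  have below: "N \<le> M" if "M \<ge> k" "\<forall>n\<ge>M. fermat_weber (chain n k) = root_vertex n k" for M
    using least root_iff that by blast
  show ?thesis
    unfolding P_def[symmetric] using above below PN least by (intro exI[of _ N]) (simp add: P_def)
qed

end
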